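(* Let $(X,\mathsf{d})$ be a geodesic metric space, and let $Z$ be a finite subset of $X$, regarded as a metric space with the restricted metric $\mathsf{d}|_Z$. Let $\mu_{Z,\sharp}:=\sum_{z\in Z}\delta_z$ be the counting measure on $X$ supported on $Z$, where $\delta_z$ is the delta measure at $z$. Then, for each $N\in\mathbb{Z}_{>0}$, $$\mathrm{Mag}(X,\mathsf{d},\mu_{Z,\sharp},\Gamma^{\mathrm{triv}};N)=\mathrm{Mag}(Z,\mathsf{d}|_Z,\mu_{Z,\sharp},\Gamma^{\mathrm{triv}};N).$$ Moreover, this converges as $N\to\infty$ after scaling up $\mathsf{d}$ if necessary, i.e. there is $t_0>0$ such that, for all $t\ge t_0$, the quantity with $\mathsf{d}$ replaced by $t\mathsf{d}$ converges as $N\to\infty$.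
   Context: A geodesic metric space is a metric space in which any two points are joined by a path whose length equals their distance. For $n\ge 1$, $P_n(X):=\{(x_0,\dots,x_n)\in X^{n+1}\mid x_{k-1}\ne x_k \text{ for } k=1,\dots,n\}$. Let $\Omega_{x,y}$ be the set of non-constant length-minimising geodesics from $x$ to $y$ (empty if $x=y$). $\Gamma^{\mathrm{triv}}_{x,y}$ is the measure on the trivial $\sigma$-algebra $\{\emptyset,\Omega_{x,y}\}$ with $\Gamma^{\mathrm{triv}}_{x,y}(\Omega_{x,y})=1$ if $\Omega_{x,y}\neq\emptyset$. For $\bm{x}\in P_n(X)$, $\Omega_{\bm{x}}=\prod_{k=1}^n\Omega_{x_{k-1},x_k}$ carries the product measure $\Gamma^{\mathrm{triv}}_{\bm{x}}$, and $\mathrm{Len}(\gamma)=\sum_{k=1}^n\mathsf{d}(x_{k-1},x_k)$ for $\gamma\in\Omega_{\bm{x}}$. For a Borel measure $\mu$ with $\mu(X)<\infty$, $$\mathrm{Mag}(X,\mathsf{d},\mu,\Gamma^{\mathrm{triv}};N):=\mu(X)+\sum_{n=1}^N(-1)^n\int_{P_n(X)}\Big(\int_{\Omega_{\bm{x}}}e^{-\mathrm{Len}(\gamma)}\,\mathrm{d}\Gamma^{\mathrm{triv}}_{\bm{x}}\Big)\mathrm{d}\mu^{n+1},$$ with $\mu^{n+1}$ the product measure on $X^{n+1}$. Convention for finite metric spaces such as $(Z,\mathsf{d}|_Z)$: any two distinct points are declared to be joined by exactly one geodesic (of length equal to their distance), so $\Omega_{x,y}$ is a singleton for $x\neq y$,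 and the same formula defines $\mathrm{Mag}(Z,\mathsf{d}|_Z,\mu_{Z,\sharp},\Gamma^{\mathrm{triv}};N)$. *)

theory Defs
  imports "HOL-Probability.Probability"
begin

section \<open>Length of curves and geodesic spaces\<close>

text \<open>
  The length of \<open>\<gamma>\<close> on \<open>[a,b]\<close>, for \<open>a \<le> b\<close>: the supremum of the polygonal lengths over all
  partitions \<open>a = p 0 \<le> \<dots> \<le> p n = b\<close>; possibly infinite.
\<close>

definition curve_length :: "('a \<Rightarrow> 'a \<Rightarrow> real) \<Rightarrow> (real \<Rightarrow> 'a) \<Rightarrow> real \<Rightarrow> real \<Rightarrow> ereal" where
  "curve_length d \<gamma> a b =
     Sup {ereal (\<Sum>k<n. d (\<gamma> (p k)) (\<gamma> (p (Suc k)))) | n p.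
            p 0 = a \<and> p n = b \<and> (\<forall>k<n. p k \<le> p (Suc k))}"

locale Geodesic_space = Metric_space M d for M :: "'a set" and d +
  assumes geodesic:
    "\<lbrakk>x \<in> M; y \<in> M\<rbrakk> \<Longrightarrow>
       \<exists>\<gamma>. pathin mtopology \<gamma> \<and> \<gamma> 0 = x \<and> \<gamma> 1 = y \<and> curve_length d \<gamma> 0 1 = ereal (d x y)"

text \<open>
  The non-constant length-minimising geodesics from \<open>x\<close> to \<open>y\<close>. So that every geodesic is counted
  once, and not once for every parametrisation, it is represented by its parametrisation on
  \<open>[0,1]\<close> proportional to arc length, which is \<open>undefined\<close> outside \<open>[0,1]\<close>.
\<close>

definition min_geodesics :: "'a set \<Rightarrow> ('a \<Rightarrow> 'a \<Rightarrow> real) \<Rightarrow> 'a \<Rightarrow> 'a \<Rightarrow> (real \<Rightarrow> 'a) set" where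
  "min_geodesics M d x y =
     {\<gamma> \<in> extensional {0..1}.
        pathin (Metric_space.mtopology M d) \<gamma> \<and> \<gamma> 0 = x \<and> \<gamma> 1 = y \<and>
        (\<exists>s\<in>{0..1}. \<exists>t\<in>{0..1}. \<gamma> s \<noteq> \<gamma> t) \<and>
        curve_length d \<gamma> 0 1 = ereal (d x y) \<and>
        (\<forall>t\<in>{0..1}. curve_length d \<gamma> 0 t = ereal t * curve_length d \<gamma> 0 1)}"

text \<open>
  The convention for finite metric spaces: one formal geodesic, represented by \<open>()\<close>, between any
  two distinct points, and none from a point to itself.
\<close>

definition formal_geodesics :: "'a \<Rightarrow> 'a \<Rightarrow> unit set" where
  "formal_geodesics x y = (if x = y then {} else {()})"

text \<open>
  The measure \<open>\<Gamma>\<^sup>t\<^sup>r\<^sup>i\<^sup>v\<close> for a family \<open>\<Omega>\<close> of sets of geodesics.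
\<close>

definition triv_measure :: "('a \<Rightarrow> 'a \<Rightarrow> 'g set) \<Rightarrow> 'a \<Rightarrow> 'a \<Rightarrow> 'g measure" where
  "triv_measure \<Omega> x y =
     measure_of (\<Omega> x y) {{}, \<Omega> x y} (\<lambda>A. if A = {} then 0 else 1)"

section \<open>Magnitude\<close>

definition metric_borel :: "'a set \<Rightarrow> ('a \<Rightarrow> 'a \<Rightarrow> real) \<Rightarrow> 'a measure" where
  "metric_borel M d = sigma M {U. openin (Metric_space.mtopology M d) U}"

definition P_chains :: "'a set \<Rightarrow> nat \<Rightarrow> (nat \<Rightarrow> 'a) set" where
  "P_chains M n = {x \<in> {0..n} \<rightarrow>\<^sub>E M. \<forall>k\<in>{1..n}. x (k - 1) \<noteq> x k}"

text \<open>The length of any \<open>\<gamma> \<in> \<Omega>\<^sub>x\<close>, which depends on the chain \<open>x\<close> only.\<close>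

definition chain_length :: "('a \<Rightarrow> 'a \<Rightarrow> real) \<Rightarrow> nat \<Rightarrow> (nat \<Rightarrow> 'a) \<Rightarrow> real" where
  "chain_length d n x = (\<Sum>k=1..n. d (x (k - 1)) (x k))"

text \<open>
  The product measure on \<open>M\<^sup>n\<^sup>+\<^sup>1\<close> is completed: if \<open>M\<close> is not separable, \<^term>\<open>P_chains M n\<close> need
  not be measurable for the product of the Borel sigma-algebras, although it is open. The completion
  does not affect the integral of functions measurable for the product sigma-algebra.
\<close>

definition Mag ::
  "'a set \<Rightarrow> ('a \<Rightarrow> 'a \<Rightarrow> real) \<Rightarrow> 'a measure \<Rightarrow> ('a \<Rightarrow> 'a \<Rightarrow> 'g measure) \<Rightarrow> nat \<Rightarrow> real" where
  "Mag M d \<mu> \<Gamma> N =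
     measure \<mu> M +
     (\<Sum>n=1..N. (-1) ^ n *
        (LINT x : P_chains M n | completion (\<Pi>\<^sub>M i\<in>{0..n}. \<mu>).
           (LINT \<gamma> | (\<Pi>\<^sub>M k\<in>{1..n}. \<Gamma> (x (k - 1)) (x k)). exp (- chain_length d n x))))"

definition sum_delta :: "'a set \<Rightarrow> ('a \<Rightarrow> 'a \<Rightarrow> real) \<Rightarrow> 'a set \<Rightarrow> 'a measure" where
  "sum_delta M d Z =
     measure_of M (sets (metric_borel M d)) (\<lambda>A. \<Sum>z\<in>Z. emeasure (return (metric_borel M d) z) A)"

definition scale_dist :: "real \<Rightarrow> ('a \<Rightarrow> 'a \<Rightarrow> real) \<Rightarrow> 'a \<Rightarrow> 'a \<Rightarrow> real" where
  "scale_dist t d x y = t * d x y"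

text \<open>
  The magnitude of a geodesic space \<open>(M,d)\<close>, respectively of a finite metric space \<open>(Z,d)\<close>, with
  respect to \<open>\<Sum>\<^bsub>z\<in>Z\<^esub> \<delta>\<^sub>z\<close> and \<open>\<Gamma>\<^sup>t\<^sup>r\<^sup>i\<^sup>v\<close>. The restriction of \<open>d\<close> to \<open>Z\<close> is expressed by passing the
  carrier \<open>Z\<close> together with the same \<open>d\<close>.
\<close>

definition Mag_geodesic :: "'a set \<Rightarrow> ('a \<Rightarrow> 'a \<Rightarrow> real) \<Rightarrow> 'a set \<Rightarrow> nat \<Rightarrow> real" where
  "Mag_geodesic M d Z N = Mag M d (sum_delta M d Z) (triv_measure (min_geodesics M d)) N"

definition Mag_finite :: "('a \<Rightarrow> 'a \<Rightarrow> real) \<Rightarrow> 'a set \<Rightarrow> nat \<Rightarrow> real" where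
  "Mag_finite d Z N = Mag Z d (sum_delta Z d Z) (triv_measure formal_geodesics) N"

end

theory Submission
  imports Defs
begin

text \<open>
  The product measure is the counting measure on \<open>Z\<^sup>n\<^sup>+\<^sup>1\<close>, and the measures \<open>\<Gamma>\<^sup>t\<^sup>r\<^sup>i\<^sup>v\<close> between distinct
  points are probability measures as soon as geodesics exist, so both magnitudes are the same
  alternating sum of \<open>exp (- len)\<close> over the chains in \<open>Z\<close>. If \<open>\<delta>\<close> separates the points of \<open>Z\<close>, the
  \<open>n\<close>-th term for \<open>t d\<close> is at most \<open>card Z * (card Z * exp (- t \<delta>)) ^ n\<close>, a geometric bound for large \<open>t\<close>.
\<close>

section \<open>Geodesics parametrised proportionally to arc length\<close>

lemma curve_length_ge:
  assumes "p 0 = a" "p n = b" "\<And>k. k < n \<Longrightarrow> p k \<le> p (Suc k)"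
  shows "ereal (\<Sum>k<n. d (\<gamma> (p k)) (\<gamma> (p (Suc k)))) \<le> curve_length d \<gamma> a b"
  unfolding curve_length_def by (rule Sup_upper) (use assms in blast)

text \<open>The polygonal length of every partition telescopes to the same value, so the supremum is
  taken over a constant.\<close>

lemma curve_length_proportional:
  assumes "a \<le> b" "\<And>u v. \<lbrakk>a \<le> u; u \<le> v; v \<le> b\<rbrakk> \<Longrightarrow> d (\<gamma> u) (\<gamma> v) = (v - u) * L"
  shows "curve_length d \<gamma> a b = ereal ((b - a) * L)"
proof (rule antisym)
  show "curve_length d \<gamma> a b \<le> ereal ((b - a) * L)"
    unfolding curve_length_def
  proof (rule Sup_least, clarify)
    fix n and p :: "nat \<Rightarrow> real"
    assume a: "a = p 0" and b: "b = p n" and le: "\<forall>k<n. p k \<le> p (Suc k)"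
    \<comment> \<open>Monotonicity keeps all partition points in \<open>[a,b]\<close>, where the
      distances are known.\<close>
    have mono: "p j \<le> p k" if "j \<le> k" "k \<le> n" for j k
      using that
    proof (induction k rule: dec_induct)
      case (step k)
      then show ?case using le by (meson Suc_le_lessD less_imp_le order_trans)
    qed simp
    have "(\<Sum>k<n. d (\<gamma> (p k)) (\<gamma> (p (Suc k)))) = (\<Sum>k<n. p (Suc k) * L - p k * L)"
      by (intro sum.cong refl, subst assms(2)) (auto simp: a b algebra_simps intro!: mono)
    also have "\<dots> = (p n - p 0) * L"
      by (subst sum_lessThan_telescope) (simp add: algebra_simps)
    finally show "ereal (\<Sum>k<n. d (\<gamma> (p k)) (\<gamma> (p (Suc k)))) \<le> ereal ((p n - p 0) * L)"
      by simp
  qed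
  show "ereal ((b - a) * L) \<le> curve_length d \<gamma> a b"
    using curve_length_ge[of "\<lambda>k. if k = 0 then a else b" a 1 b d \<gamma>] assms by simp
qed

text \<open>The distance formula alone yields continuity, with Lipschitz constant
  \<open>d x y\<close>, and the lengths of all initial segments.\<close>

lemma (in Metric_space) min_geodesics_nonempty:
  assumes "x \<in> M" "y \<in> M" "x \<noteq> y" "\<gamma> \<in> {0..1} \<rightarrow> M" "\<gamma> 0 = x" "\<gamma> 1 = y"
    and d: "\<And>u v. \<lbrakk>0 \<le> u; u \<le> v; v \<le> 1\<rbrakk> \<Longrightarrow> d (\<gamma> u) (\<gamma> v) = (v - u) * d x y"
  shows "min_geodesics M d x y \<noteq> {}"
proof -
  define \<gamma>' where "\<gamma>' = restrict \<gamma> {0..1}"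
  have d': "d (\<gamma>' u) (\<gamma>' v) = (v - u) * d x y" if "0 \<le> u" "u \<le> v" "v \<le> 1" for u v
    using d that by (simp add: \<gamma>'_def)
  have dabs: "d (\<gamma>' u) (\<gamma>' v) = \<bar>u - v\<bar> * d x y" if "u \<in> {0..1}" "v \<in> {0..1}" for u v
  proof (cases "u \<le> v")
    case True
    then show ?thesis using d'[of u v] that by simp
  next
    case False
    then show ?thesis using d'[of v u] that by (subst commute) simp
  qed
  have len: "curve_length d \<gamma>' 0 t = ereal (t * d x y)" if "t \<in> {0..1}" for t
    using curve_length_proportional[of 0 t d \<gamma>' "d x y"] d' that by simp
  have "Lipschitz_continuous_map (submetric euclidean_metric {0..1}) (metric (M, d)) \<gamma>'"
    unfolding Lipschitz_continuous_map_def
  proof (intro conjI exI ballI)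
    show "\<gamma>' \<in> mspace (submetric euclidean_metric {0..1}) \<rightarrow> mspace (metric (M, d))"
      using assms(4) by (auto simp: \<gamma>'_def)
    fix u v :: real
    assume "u \<in> mspace (submetric euclidean_metric {0..1})"
      "v \<in> mspace (submetric euclidean_metric {0..1})"
    then show "mdist (metric (M, d)) (\<gamma>' u) (\<gamma>' v)
        \<le> d x y * mdist (submetric euclidean_metric {0..1}) u v"
      using dabs[of u v] by (simp add: dist_real_def)
  qed
  then have "pathin mtopology \<gamma>'"
    unfolding pathin_def
    by (drule_tac Lipschitz_continuous_imp_continuous_map) (simp add: mtopology_of_submetric)
  moreover have "\<gamma>' 0 = x" "\<gamma>' 1 = y" "\<gamma>' \<in> extensional {0..1}"
    using assms by (auto simp: \<gamma>'_def)
  moreover have "\<exists>s\<in>{0..1}. \<exists>t\<in>{0..1}. \<gamma>' s \<noteq> \<gamma>' t"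
    using assms(3) calculation by (intro bexI[of _ 0] bexI[of _ 1]) auto
  ultimately have "\<gamma>' \<in> min_geodesics M d x y"
    using len by (simp add: min_geodesics_def)
  then show ?thesis by blast
qed

text \<open>
  Along a path whose length is the distance of its endpoints the triangle inequality is sharp, so
  \<open>d x (\<gamma> s)\<close> is an arc length parameter; the intermediate value theorem provides every value of it.
\<close>

lemma (in Geodesic_space) proportional_geodesic:
  assumes "x \<in> M" "y \<in> M"
  obtains \<gamma> where "\<gamma> \<in> {0..1} \<rightarrow> M" "\<gamma> 0 = x" "\<gamma> 1 = y"
    "\<And>u v. \<lbrakk>0 \<le> u; u \<le> v; v \<le> (1::real)\<rbrakk> \<Longrightarrow> d (\<gamma> u) (\<gamma> v) = (v - u) * d x y"
proof -
  obtain \<gamma> where path: "pathin mtopology \<gamma>" and ends: "\<gamma> 0 = x" "\<gamma> 1 = y"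
    and len: "curve_length d \<gamma> 0 1 = ereal (d x y)"
    using geodesic[OF assms] by blast
  have inM: "\<gamma> s \<in> M" if "s \<in> {0..1}" for s
    using path that continuous_map_image_subset_topspace unfolding pathin_def by fastforce
  define \<phi> where "\<phi> s = d x (\<gamma> s)" for s
  have step: "d (\<gamma> s) (\<gamma> t) = \<phi> t - \<phi> s" if st: "0 \<le> s" "s \<le> t" "t \<le> 1" for s t
  proof -
    \<comment> \<open>The partition \<open>0 \<le> s \<le> t \<le> 1\<close> bounds the detour
      through \<open>\<gamma> s\<close> and \<open>\<gamma> t\<close> by \<open>d x y\<close>; the
      two triangle inequalities below then force equality.\<close>
    have "ereal (d x (\<gamma> s) + d (\<gamma> s) (\<gamma> t) + d (\<gamma> t) y) \<le> ereal (d x y)"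
      using curve_length_ge[of "\<lambda>k. if k = 0 then 0 else if k = 1 then s else if k = 2 then t else 1"
        0 3 1 d \<gamma>] st
      by (simp add: len ends numeral_3_eq_3 numeral_2_eq_2)
    moreover have "d x y \<le> d x (\<gamma> t) + d (\<gamma> t) y" "d x (\<gamma> t) \<le> d x (\<gamma> s) + d (\<gamma> s) (\<gamma> t)"
      using assms inM st by (auto intro!: triangle)
    ultimately show ?thesis by (simp add: \<phi>_def)
  qed
  have "continuous_map (top_of_set {0..1}) euclideanreal \<phi>"
    unfolding \<phi>_def using path assms
      continuous_map_mdist[of "top_of_set {0..1}" "metric (M, d)" "\<lambda>_. x" \<gamma>]
    by (simp add: pathin_def)
  then have cont: "continuous_on {0..1} \<phi>" by simp
  have "\<exists>s\<in>{0..1}. \<phi> s = u * d x y" if "u \<in> {0..1}" for u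
  proof -
    have "\<exists>s\<ge>0. s \<le> 1 \<and> \<phi> s = u * d x y"
      using that cont assms ends
      by (intro IVT') (auto simp: \<phi>_def mult_left_le_one_le)
    then show ?thesis by auto
  qed
  \<comment> \<open>\<open>\<sigma>\<close> is a pointwise choice and may jump where
    \<open>\<gamma>\<close> pauses. Only the distances along
    \<open>\<gamma> \<circ> \<sigma>\<close> matter: \<open>min_geodesics_nonempty\<close> derives
    continuity from them.\<close>
  then obtain \<sigma> where \<sigma>: "\<And>u. u \<in> {0..1} \<Longrightarrow> \<sigma> u \<in> {0..1} \<and> \<phi> (\<sigma> u) = u * d x y"
    by metis
  show thesis
  proof (rule that[of "\<gamma> \<circ> \<sigma>"])
    show "\<gamma> \<circ> \<sigma> \<in> {0..1} \<rightarrow> M" using \<sigma> inM by auto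
    have "d x (\<gamma> (\<sigma> 0)) = 0" using \<sigma>[of 0] by (simp add: \<phi>_def)
    then show "(\<gamma> \<circ> \<sigma>) 0 = x" using \<sigma>[of 0] inM assms by auto
    have "d (\<gamma> (\<sigma> 1)) (\<gamma> 1) = 0" using step[of "\<sigma> 1" 1] \<sigma>[of 1] by (simp add: \<phi>_def ends)
    then show "(\<gamma> \<circ> \<sigma>) 1 = y" using \<sigma>[of 1] inM[of "\<sigma> 1"] assms ends by auto
    fix u v :: real
    assume uv: "0 \<le> u" "u \<le> v" "v \<le> 1"
    \<comment> \<open>For \<open>x = y\<close> the choice \<open>\<sigma>\<close> can reverse the
      order, hence the absolute value.\<close>
    have "d (\<gamma> (\<sigma> u)) (\<gamma> (\<sigma> v)) = \<bar>\<phi> (\<sigma> v) - \<phi> (\<sigma> u)\<bar>"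
    proof (cases "\<sigma> u \<le> \<sigma> v")
      case True
      then show ?thesis
        using step[of "\<sigma> u" "\<sigma> v"] \<sigma>[of u] \<sigma>[of v] uv nonneg[of "\<gamma> (\<sigma> u)" "\<gamma> (\<sigma> v)"] by simp
    next
      case False
      then show ?thesis
        using step[of "\<sigma> v" "\<sigma> u"] \<sigma>[of u] \<sigma>[of v] uv nonneg[of "\<gamma> (\<sigma> v)" "\<gamma> (\<sigma> u)"]
        by (subst commute) simp
    qed
    then show "d ((\<gamma> \<circ> \<sigma>) u) ((\<gamma> \<circ> \<sigma>) v) = (v - u) * d x y"
      using \<sigma>[of u] \<sigma>[of v] uv by (simp add: abs_mult flip: left_diff_distrib)
  qed
qed

section \<open>Scaled metrics\<close>

lemma Metric_space_scale_dist:
  assumes "Metric_space M d" "t > 0"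
  shows "Metric_space M (scale_dist t d)"
proof -
  interpret Metric_space M d by fact
  show ?thesis
  proof
    show "scale_dist t d x y = scale_dist t d y x" for x y
      unfolding scale_dist_def by (subst commute) (rule refl)
    show "scale_dist t d x z \<le> scale_dist t d x y + scale_dist t d y z"
      if "x \<in> M" "y \<in> M" "z \<in> M" for x y z
      using triangle[OF that] assms(2) by (simp add: scale_dist_def flip: distrib_left)
  qed (use assms(2) in \<open>auto simp: scale_dist_def\<close>)
qed

text \<open>The distance formula is linear in the metric, so it passes from \<open>d\<close> to
  \<open>scale_dist t d\<close>; this avoids comparing curve lengths and topologies of the two
  metrics.\<close>

lemma (in Geodesic_space) min_geodesics_scale_dist_nonempty:
  assumes "x \<in> M" "y \<in> M" "x \<noteq> y" "t > 0"
  shows "min_geodesics M (scale_dist t d) x y \<noteq> {}"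
proof -
  interpret scaled: Metric_space M "scale_dist t d"
    by (rule Metric_space_scale_dist) (use assms Metric_space_axioms in auto)
  obtain \<gamma> where \<gamma>: "\<gamma> \<in> {0..1} \<rightarrow> M" "\<gamma> 0 = x" "\<gamma> 1 = y"
    "\<And>u v. \<lbrakk>0 \<le> u; u \<le> v; v \<le> (1::real)\<rbrakk> \<Longrightarrow> d (\<gamma> u) (\<gamma> v) = (v - u) * d x y"
    using proportional_geodesic[OF assms(1,2)] by blast
  show ?thesis
    by (rule scaled.min_geodesics_nonempty[OF assms(1-3) \<gamma>(1-3)]) (simp add: scale_dist_def \<gamma>(4))
qed

section \<open>Magnitude with respect to a finite counting measure\<close>

text \<open>Of pairwise disjoint members of \<open>{{}, \<Omega> x y}\<close> at most one is
  nonempty, which gives countable additivity; the total mass is \<open>1\<close> because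
  \<open>\<Omega> x y\<close> is nonempty.\<close>

lemma prob_space_triv_measure:
  assumes "\<Omega> x y \<noteq> {}"
  shows "prob_space (triv_measure \<Omega> x y)"
proof
  have ca: "countably_additive {{}, \<Omega> x y} (\<lambda>A. if A = {} then 0 else 1 :: ennreal)"
  proof (rule countably_additiveI)
    fix A :: "nat \<Rightarrow> _"
    assume A: "range A \<subseteq> {{}, \<Omega> x y}" "disjoint_family A"
    show "(\<Sum>i. if A i = {} then 0 else 1 :: ennreal) = (if (\<Union>i. A i) = {} then 0 else 1)"
    proof (cases "\<exists>j. A j \<noteq> {}")
      case True
      then obtain j where j: "A j \<noteq> {}" by blast
      have "A i = {}" if "i \<noteq> j" for i
      proof -
        have "A i \<inter> A j = {}" using A(2) that by (auto simp: disjoint_family_on_def)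
        moreover have "A i \<in> {{}, \<Omega> x y}" "A j \<in> {{}, \<Omega> x y}" using A(1) by auto
        ultimately show ?thesis using j by auto
      qed
      then have "(\<Sum>i. if A i = {} then 0 else 1 :: ennreal) = (\<Sum>i\<in>{j}. if A i = {} then 0 else 1)"
        by (intro suminf_finite) auto
      then show ?thesis using j by auto
    qed auto
  qed
  have "sigma_sets (\<Omega> x y) {{}, \<Omega> x y} = {{}, \<Omega> x y}"
    by (rule sigma_algebra.sigma_sets_eq) (rule sigma_algebra_trivial)
  then have "emeasure (triv_measure \<Omega> x y) (\<Omega> x y) = 1"
    using assms ca
    by (subst emeasure_measure_of[OF triv_measure_def])
       (auto simp: positive_def triv_measure_def sets_measure_of)
  moreover have "space (triv_measure \<Omega> x y) = \<Omega> x y"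
    by (simp add: triv_measure_def space_measure_of_conv)
  ultimately show "emeasure (triv_measure \<Omega> x y) (space (triv_measure \<Omega> x y)) = 1"
    by simp
qed

section \<open>Borel sets and the sum of point masses\<close>

lemma space_sum_delta [simp]: "space (sum_delta M d Z) = M"
  by (simp add: sum_delta_def space_measure_of_conv)

lemma sets_metric_borel_subset: "sets (metric_borel M d) \<subseteq> Pow M"
  using sets.sets_into_space[of _ "metric_borel M d"]
  by (auto simp: metric_borel_def space_measure_of_conv)

lemma space_metric_borel [simp]: "space (metric_borel M d) = M"
  by (simp add: metric_borel_def space_measure_of_conv)

lemma sets_sum_delta: "sets (sum_delta M d Z) = sets (metric_borel M d)"
  unfolding sum_delta_def
  using sets.sigma_sets_eq[of "metric_borel M d"] sets_metric_borel_subset[of M d]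
  by (simp add: sets_measure_of)

text \<open>Countable additivity is inherited from the point masses, as the finite sum over
  \<open>Z\<close> commutes with the series.\<close>

lemma emeasure_sum_delta:
  assumes "finite Z" "A \<in> sets (sum_delta M d Z)"
  shows "emeasure (sum_delta M d Z) A = of_nat (card (A \<inter> Z))"
proof -
  let ?B = "metric_borel M d"
  have "emeasure (sum_delta M d Z) A = (\<Sum>z\<in>Z. emeasure (return ?B z) A)"
  proof (rule emeasure_measure_of[OF sum_delta_def])
    show "countably_additive (sets (sum_delta M d Z)) (\<lambda>A. \<Sum>z\<in>Z. emeasure (return ?B z) A)"
    proof (rule countably_additiveI)
      fix A :: "nat \<Rightarrow> _"
      assume "range A \<subseteq> sets (sum_delta M d Z)" "disjoint_family A"
      then show "(\<Sum>i. \<Sum>z\<in>Z. emeasure (return ?B z) (A i)) = (\<Sum>z\<in>Z. emeasure (return ?B z) (\<Union>i. A i))"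
        using suminf_emeasure[of A "return ?B z" for z]
        by (subst suminf_sum) (auto simp: sets_sum_delta simp del: emeasure_return intro!: sum.cong)
    qed
  qed (use assms sets_metric_borel_subset in \<open>auto simp: positive_def\<close>)
  also have "\<dots> = (\<Sum>z\<in>Z. indicator A z)"
    using assms by (simp add: sets_sum_delta)
  also have "\<dots> = of_nat (card (A \<inter> Z))"
    using assms by (simp add: indicator_def sum.If_cases Int_commute Collect_conj_eq)
  finally show ?thesis .
qed

text \<open>Metric topologies are Hausdorff, so finite sets are closed. This serves for singletons
  and for \<open>Z\<close> itself.\<close>

lemma (in Metric_space) finite_in_sets_sum_delta:
  assumes "finite A" "A \<subseteq> M"
  shows "A \<in> sets (sum_delta M d Z)"
proof -
  have "openin mtopology (M - A)"
    using assms by (metis closedin_Hausdorff_finite_eq Hausdorff_space_mtopology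
        closedin_def topspace_mtopology)
  then have "M - A \<in> sets (metric_borel M d)"
    unfolding metric_borel_def
    by (subst sets_measure_of) (use openin_subset[of mtopology] in auto)
  then have "M - (M - A) \<in> sets (metric_borel M d)"
    using sets.compl_sets[of "M - A" "metric_borel M d"] by simp
  then show ?thesis
    using assms by (simp add: sets_sum_delta double_diff)
qed

lemma finite_measure_sum_delta:
  assumes "finite Z" shows "finite_measure (sum_delta M d Z)"
  using emeasure_sum_delta[OF assms, of M M d] sets.top[of "sum_delta M d Z"]
  by (intro finite_measureI) simp

text \<open>
  Outside the finitely many points of \<open>Z\<^sup>n\<^sup>+\<^sup>1\<close> the product measure vanishes, so in its completion
  every set is measurable.
\<close>

lemma (in Metric_space) integral_completion_PiM_sum_delta:
  fixes f :: "('i \<Rightarrow> 'a) \<Rightarrow> real"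
  assumes Z: "finite Z" "Z \<subseteq> M" and I: "finite I"
  shows "(LINT x | completion (\<Pi>\<^sub>M i\<in>I. sum_delta M d Z). f x) = (\<Sum>x\<in>I \<rightarrow>\<^sub>E Z. f x)"
proof -
  let ?\<mu> = "sum_delta M d Z"
  let ?P = "\<Pi>\<^sub>M i\<in>I. ?\<mu>"
  let ?F = "I \<rightarrow>\<^sub>E Z"
  interpret \<mu>: finite_measure ?\<mu> by (rule finite_measure_sum_delta) fact
  interpret product_sigma_finite "\<lambda>_. ?\<mu>" by unfold_locales
  have finF: "finite ?F" using Z I by (simp add: finite_PiE)
  have space: "space ?P = I \<rightarrow>\<^sub>E M" by (simp add: space_PiM)
  have FP: "?F \<subseteq> space ?P" using Z by (auto simp: space)
  have sing: "{x} \<in> sets ?P \<and> emeasure ?P {x} = 1" if "x \<in> ?F" for x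
  proof -
    have eq: "{x} = (\<Pi>\<^sub>E i\<in>I. {x i})"
      using that by (subst PiE_singleton) (auto simp: PiE_iff)
    have x: "x i \<in> Z \<and> x i \<in> M" if "i \<in> I" for i
      using \<open>x \<in> ?F\<close> that Z by auto
    then have s: "{x i} \<in> sets ?\<mu>" if "i \<in> I" for i
      using that by (intro finite_in_sets_sum_delta) auto
    have "emeasure ?P {x} = (\<Prod>i\<in>I. emeasure ?\<mu> {x i})"
      unfolding eq by (rule emeasure_PiM) (use s I in auto)
    also have "\<dots> = 1"
      using x s Z by (intro prod.neutral) (auto simp: emeasure_sum_delta)
    finally show ?thesis
      using s I by (subst eq) (auto intro!: sets_PiM_I_finite)
  qed
  have Zs: "Z \<in> sets ?\<mu>" using Z by (rule finite_in_sets_sum_delta)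
  have Fs: "?F \<in> sets ?P" using Zs I by (auto intro!: sets_PiM_I_finite)
  have Ms: "M \<in> sets ?\<mu>" using sets.top[of ?\<mu>] by simp
  have eF: "emeasure ?P ?F = of_nat (card Z) ^ card I"
    using Zs I Z by (subst emeasure_PiM) (auto simp: emeasure_sum_delta)
  have eP: "emeasure ?P (space ?P) = of_nat (card Z) ^ card I"
    unfolding space using Ms I Z
    by (subst emeasure_PiM) (auto simp: emeasure_sum_delta Int_absorb1)
  \<comment> \<open>\<open>?F\<close> and the whole space have the same finite mass.\<close>
  have null: "space ?P - ?F \<in> null_sets ?P"
    using Fs FP eF eP by (intro null_setsI) (auto simp: emeasure_Diff power_eq_top_ennreal)
  \<comment> \<open>\<open>A\<close> splits into finitely many measurable points and a subset of a
    null set.\<close>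
  have all: "A \<in> sets (completion ?P)" if "A \<subseteq> space ?P" for A
  proof (rule sets_completionI[where S = "A \<inter> ?F" and N = "A - ?F" and N' = "space ?P - ?F"])
    have "(\<Union>x\<in>A \<inter> ?F. {x}) \<in> sets ?P"
      using finF sing by (intro sets.finite_UN) auto
    then show "A \<inter> ?F \<in> sets ?P" by simp
  qed (use that null in auto)
  have meas: "g \<in> borel_measurable (completion ?P)" for g :: "('i \<Rightarrow> 'a) \<Rightarrow> real"
    by (rule measurableI) (auto intro!: all)
  have AE: "AE x in completion ?P. f x = (\<Sum>y\<in>?F. f y * indicator {y} x)"
  proof (rule AE_completion, rule AE_I'[OF null])
    show "{x \<in> space ?P. f x \<noteq> (\<Sum>y\<in>?F. f y * indicator {y} x)} \<subseteq> space ?P - ?F"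
      using finF by (auto simp: indicator_def sum.delta')
  qed
  have "(LINT x | completion ?P. f x) = (LINT x | completion ?P. (\<Sum>y\<in>?F. f y * indicator {y} x))"
    by (rule integral_cong_AE[OF meas meas AE])
  also have "\<dots> = (\<Sum>y\<in>?F. f y * measure (completion ?P) {y})"
    using sing FP
    by (subst Bochner_Integration.integral_sum)
       (auto simp: Int_absorb2 intro!: sum.cong)
  also have "\<dots> = (\<Sum>y\<in>?F. f y)"
    using sing by (intro sum.cong refl) (simp add: measure_def)
  finally show ?thesis .
qed

text \<open>The right-hand side no longer mentions \<open>M\<close>: used with the carriers
  \<open>X\<close> and \<open>Z\<close>, it identifies the two magnitudes.\<close>

lemma (in Metric_space) Mag_sum_delta:
  assumes Z: "finite Z" "Z \<subseteq> M"
    and \<Gamma>: "\<And>x y. \<lbrakk>x \<in> Z; y \<in> Z; x \<noteq> y\<rbrakk> \<Longrightarrow> prob_space (\<Gamma> x y)"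
  shows "Mag M d (sum_delta M d Z) \<Gamma> N =
    card Z + (\<Sum>n=1..N. (-1) ^ n * (\<Sum>x\<in>P_chains Z n. exp (- chain_length d n x)))"
proof -
  have "measure (sum_delta M d Z) M = card Z"
    using Z emeasure_sum_delta[OF Z(1), of M M d] sets.top[of "sum_delta M d Z"]
    by (simp add: measure_def Int_absorb1)
  moreover have "(LINT x : P_chains M n | completion (\<Pi>\<^sub>M i\<in>{0..n}. sum_delta M d Z).
      (LINT \<gamma> | (\<Pi>\<^sub>M k\<in>{1..n}. \<Gamma> (x (k - 1)) (x k)). exp (- chain_length d n x))) =
      (\<Sum>x\<in>P_chains Z n. exp (- chain_length d n x))" for n
  proof -
    \<comment> \<open>Consecutive points of a chain are distinct, so every factor is a probability
      measure, and the integrand is constant in \<open>\<gamma>\<close>.\<close>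
    have *: "(LINT \<gamma> | (\<Pi>\<^sub>M k\<in>{1..n}. \<Gamma> (x (k - 1)) (x k)). exp (- chain_length d n x)) =
      exp (- chain_length d n x)" if "x \<in> P_chains Z n" for x
    proof -
      have "prob_space (\<Pi>\<^sub>M k\<in>{1..n}. \<Gamma> (x (k - 1)) (x k))"
        using that by (intro prob_space_PiM \<Gamma>) (auto simp: P_chains_def)
      then show ?thesis by (simp only: lebesgue_integral_const prob_space.prob_space scaleR_one)
    qed
    have sub: "x \<in> P_chains Z n \<longleftrightarrow> x \<in> P_chains M n" if "x \<in> {0..n} \<rightarrow>\<^sub>E Z" for x
      using that Z(2) by (auto simp: P_chains_def)
    have "P_chains Z n \<subseteq> {0..n} \<rightarrow>\<^sub>E Z" by (auto simp: P_chains_def)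
    then show ?thesis
      unfolding set_lebesgue_integral_def
      using Z by (subst integral_completion_PiM_sum_delta)
        (auto simp: sub *[simplified] finite_PiE indicator_def intro!: sum.mono_neutral_cong_right)
  qed
  ultimately show ?thesis by (simp add: Mag_def)
qed

section \<open>Convergence for large scaling factors\<close>

text \<open>Each of the \<open>n\<close> steps of a chain costs at least \<open>\<delta>\<close>,
  and there are at most \<open>card Z ^ (n + 1)\<close> chains.\<close>

lemma summable_chain_sum:
  assumes "finite Z" "\<delta> > 0" "\<And>x y. \<lbrakk>x \<in> Z; y \<in> Z; x \<noteq> y\<rbrakk> \<Longrightarrow> \<delta> \<le> d x y"
    and small: "card Z * exp (- \<delta>) < 1"
  shows "summable (\<lambda>n. (-1) ^ n * (\<Sum>x\<in>P_chains Z n. exp (- chain_length d n x)))"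
proof (rule summable_comparison_test')
  show "summable (\<lambda>n. card Z * (card Z * exp (- \<delta>)) ^ n)"
    using small by (intro summable_mult summable_geometric) auto
  fix n
  have len: "n * \<delta> \<le> chain_length d n x" if "x \<in> P_chains Z n" for x
  proof -
    have "(\<Sum>k=1..n. \<delta>) \<le> chain_length d n x"
      unfolding chain_length_def using that by (intro sum_mono assms(3)) (auto simp: P_chains_def)
    then show ?thesis by simp
  qed
  have sub: "P_chains Z n \<subseteq> {0..n} \<rightarrow>\<^sub>E Z" by (auto simp: P_chains_def)
  have "(\<Sum>x\<in>P_chains Z n. exp (- chain_length d n x)) \<le> (\<Sum>x\<in>P_chains Z n. exp (- (n * \<delta>)))"
    using len by (intro sum_mono) simp
  also have "\<dots> \<le> (\<Sum>x\<in>{0..n} \<rightarrow>\<^sub>E Z. exp (- (n * \<delta>)))"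
    using sub assms(1) by (intro sum_mono2) (auto simp: finite_PiE)
  also have "\<dots> = card Z * (card Z * exp (- \<delta>)) ^ n"
    using assms(1) by (simp add: card_PiE power_mult_distrib flip: exp_of_nat_mult)
  finally show "norm ((-1) ^ n * (\<Sum>x\<in>P_chains Z n. exp (- chain_length d n x)))
      \<le> card Z * (card Z * exp (- \<delta>)) ^ n"
    by (simp add: abs_mult sum_nonneg)
qed

lemma (in Metric_space) finite_separated:
  assumes "finite Z" "Z \<subseteq> M"
  obtains \<delta> where "\<delta> > 0" "\<And>x y. \<lbrakk>x \<in> Z; y \<in> Z; x \<noteq> y\<rbrakk> \<Longrightarrow> \<delta> \<le> d x y"
proof
  \<comment> \<open>The inserted \<open>1\<close> keeps the minimum defined and positive if
    \<open>Z\<close> has no two distinct points.\<close>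
  let ?D = "insert 1 ((\<lambda>(x, y). d x y) ` {(x, y) \<in> Z \<times> Z. x \<noteq> y})"
  have fin: "finite ?D"
    using assms by (auto intro: finite_subset[of _ "Z \<times> Z"])
  then show "Min ?D > 0" using assms by (subst Min_gr_iff) (auto simp: subset_iff)
  show "Min ?D \<le> d x y" if "x \<in> Z" "y \<in> Z" "x \<noteq> y" for x y
    using fin that by (intro Min_le) auto
qed

lemma convergent_add_partial_sums:
  fixes f :: "nat \<Rightarrow> real"
  assumes "summable f"
  shows "convergent (\<lambda>N. c + (\<Sum>n=1..N. f n))"
proof -
  \<comment> \<open>The sum in \<open>Mag\<close> starts at \<open>1\<close>, the series at
    \<open>0\<close>.\<close>
  have "(\<Sum>n=1..N. f n) = (\<Sum>n\<le>N. f n) - f 0" for N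
    by (simp add: sum.atMost_shift sum.atLeast1_atMost_eq)
  then show ?thesis
    using assms by (auto simp: summable_iff_convergent' intro!: convergent_add convergent_diff convergent_const)
qed

theorem lemma3p8:
  fixes X Z :: "'a set" and d :: "'a \<Rightarrow> 'a \<Rightarrow> real"
  assumes "Geodesic_space X d" and "Z \<subseteq> X" and "finite Z"
  shows "(\<forall>N>0. Mag_geodesic X d Z N = Mag_finite d Z N) \<and>
         (\<exists>t0>0. \<forall>t\<ge>t0.
            convergent (\<lambda>N. Mag_geodesic X (scale_dist t d) Z N) \<and>
            convergent (\<lambda>N. Mag_finite (scale_dist t d) Z N))"
proof -
  interpret Geodesic_space X d by fact
  let ?S = "\<lambda>d N. card Z + (\<Sum>n=1..N. (-1) ^ n * (\<Sum>x\<in>P_chains Z n. exp (- chain_length d n x)))"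
  have mag: "Mag_geodesic X (scale_dist t d) Z N = ?S (scale_dist t d) N"
    "Mag_finite (scale_dist t d) Z N = ?S (scale_dist t d) N" if "t > 0" for t N
  proof -
    interpret X: Metric_space X "scale_dist t d"
      by (rule Metric_space_scale_dist) (use that Metric_space_axioms in auto)
    interpret Z: Metric_space Z "scale_dist t d"
      by (rule X.subspace) fact
    show "Mag_geodesic X (scale_dist t d) Z N = ?S (scale_dist t d) N"
      unfolding Mag_geodesic_def using assms that
      by (intro X.Mag_sum_delta prob_space_triv_measure min_geodesics_scale_dist_nonempty) auto
    show "Mag_finite (scale_dist t d) Z N = ?S (scale_dist t d) N"
      unfolding Mag_finite_def using assms
      by (intro Z.Mag_sum_delta prob_space_triv_measure) (auto simp: formal_geodesics_def)
  qed
  \<comment> \<open>The unscaled equality is the case \<open>t = 1\<close>.\<close>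
  have "scale_dist 1 d = d" by (simp add: scale_dist_def fun_eq_iff)
  then have eq: "Mag_geodesic X d Z N = Mag_finite d Z N" for N
    using mag[of 1 N] by simp
  obtain \<delta> where \<delta>: "\<delta> > 0" "\<And>x y. \<lbrakk>x \<in> Z; y \<in> Z; x \<noteq> y\<rbrakk> \<Longrightarrow> \<delta> \<le> d x y"
    using finite_separated assms by blast
  \<comment> \<open>For \<open>t \<ge> t0\<close> this gives
    \<open>exp (t * \<delta>) \<ge> 1 + t * \<delta> > card Z\<close>, so the geometric ratio is
    below \<open>1\<close>. The \<open>+ 1\<close> makes \<open>t0\<close> positive even for empty
    \<open>Z\<close>.\<close>
  define t0 where "t0 = (card Z + 1) / \<delta>"
  have "t0 > 0" using \<delta> by (simp add: t0_def)
  moreover have "convergent (\<lambda>N. Mag_geodesic X (scale_dist t d) Z N) \<and>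
      convergent (\<lambda>N. Mag_finite (scale_dist t d) Z N)" if "t \<ge> t0" for t
  proof -
    have t: "t > 0" using that \<open>t0 > 0\<close> by linarith
    have "card Z + 1 \<le> t * \<delta>"
      using that \<delta>(1) by (simp add: t0_def field_simps)
    then have "card Z < exp (t * \<delta>)"
      using exp_ge_add_one_self[of "t * \<delta>"] by linarith
    then have "card Z * exp (- (t * \<delta>)) < 1"
      by (simp add: exp_minus field_simps)
    then have "summable (\<lambda>n. (-1) ^ n *
        (\<Sum>x\<in>P_chains Z n. exp (- chain_length (scale_dist t d) n x)))"
      using t \<delta> assms by (intro summable_chain_sum[where \<delta> = "t * \<delta>"]) (auto simp: scale_dist_def)
    then show ?thesis
      unfolding mag[OF t] by (simp only: convergent_add_partial_sums simp_thms)
  qed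
  ultimately show ?thesis using eq by blast
qed

end
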